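(* Let $\mathcal{T}$ be any countable rooted tree (i.e. a rooted tree with countably many nodes), with root $\epsilon$, and let $\nu_{\mathcal{T}}$ be its natural descent function, which sends each non-root node $a$ of $\mathcal{T}$ to its parent node. Let $p_1=2<p_2=3<p_3=5<\dots$ be the sequence of prime numbers, let $$U=\{n\in\mathbb{N} : \text{for all primes } p,q, \text{ if } p\mid n \text{ and } q<p \text{ then } q\mid n\},$$ and let $\theta_U: U\setminus\{1\}\to U$ be defined by $\theta_U\left(\prod_{i=1}^m p_i^{h_i}\right)=\prod_{i=1}^{m-1}p_i^{h_i}$ for $n=\prod_{i=1}^m p_i^{h_i}\in U$ with all $h_i\ge 1$ (that is, $\theta_U(n)=n/p_m^{h_m}$ where $p_m$ is the largest prime dividing $n$). Let $\mathcal{U}$ be the rooted tree with node set $U$, root $1$, in which the parent of each $n\neq 1$ is $\theta_U(n)$. Then there exists an injective function $j:\mathcal{T}\to\mathcal{U}$ (from the nodes of $\mathcal{T}$ to $U$) such that $j(\nu_{\mathcal{T}}(a))=\theta_U(j(a))$ for every non-root node $a$ of $\mathcal{T}$, i.e. the square formed by $\nu_{\mathcal{T}}$, $\theta_U$ and $j$ commutes.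
   Context: $\mathbb{N}$ denotes the positive integers. A rooted tree is a tree with a distinguished root node; every non-root node has a unique parent. The tree $\mathcal{U}$ is called the universal tree; it is infinite and each of its nodes has infinitely many children. *)

theory Defs
  imports
    "HOL-Computational_Algebra.Primes"
    "HOL-Library.Countable_Set"
    "HOL-Library.Infinite_Set"
    "Graph_Theory.Digraph_Component"
begin

section \<open>Rooted trees\<close>

text \<open>
  Undirected simple graphs, possibly infinite, are symmetric loop-free digraphs
  (\<^locale>\<open>pair_bidirected_digraph\<close>). In such a graph the closed walk a, b, a counts as a
  \<^const>\<open>pre_digraph.cycle\<close>, so the constant \<^const>\<open>tree\<close>, which forbids all directed
  cycles, is not the undirected notion (on symmetric graphs it admits only one-vertex graphs).
  The undirected cycles are exactly the cycles of length at least 3.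
\<close>

locale undirected_tree = pair_bidirected_digraph G for G +
  assumes connected: "strongly_connected G"
    and acyclic: "\<not> (\<exists>p. cycle p \<and> 3 \<le> length p)"

locale rooted_tree = undirected_tree G for G :: "'a pair_pre_digraph" +
  fixes r :: 'a
  assumes root_in_verts: "r \<in> pverts G"

text \<open>The parent of a non-root node is the next node on the path to the root.\<close>

definition is_parent :: "'a pair_pre_digraph \<Rightarrow> 'a \<Rightarrow> 'a \<Rightarrow> 'a \<Rightarrow> bool" where
  "is_parent G r a b \<longleftrightarrow> (\<exists>p. pre_digraph.apath (with_proj G) a ((a, b) # p) r)"

definition descent :: "'a pair_pre_digraph \<Rightarrow> 'a \<Rightarrow> 'a \<Rightarrow> 'a" where
  "descent G r a = (THE b. is_parent G r a b)"

lemma (in pair_bidirected_digraph) walk_avoiding: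
  assumes "awalk b p r" "a \<notin> set (pawalk_verts b p)"
    and "awalk c q r" "a \<notin> set (pawalk_verts c q)"
  shows "\<exists>s. apath b s c \<and> a \<notin> set (pawalk_verts b s)"
proof -
  define H where "H = \<lparr>pverts = pverts G - {a}, parcs = {e \<in> parcs G. fst e \<noteq> a \<and> snd e \<noteq> a}\<rparr>"
  have symG: "(v, u) \<in> parcs G" if "(u, v) \<in> parcs G" for u v
    using pair_sym_arcs that by (auto simp: symmetric_def sym_def)
  interpret H: pair_sym_digraph H
    by unfold_locales
      (auto simp: H_def arc_fst_in_verts arc_snd_in_verts symmetric_def sym_def symG
        dest: in_arcsD1 in_arcsD2)
  have H: "pverts H = pverts G - {a}" "parcs H = {e \<in> parcs G. fst e \<noteq> a \<and> snd e \<noteq> a}"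
    by (simp_all add: H_def)
  have tr: "H.awalk x w y" if "awalk x w y" "a \<notin> set (pawalk_verts x w)" for x w y
    using that
  proof (induction w arbitrary: x)
    case Nil
    then show ?case by (auto simp: awalk_Nil_iff H.awalk_Nil_iff H)
  next
    case (Cons e w)
    then have *: "fst e = x" "e \<in> parcs G" "awalk (snd e) w y" "a \<notin> set (pawalk_verts (snd e) w)"
      "x \<noteq> a" by (auto simp: awalk_Cons_iff)
    have "snd e \<in> set (pawalk_verts (snd e) w)" by (cases w) (use *(3) in \<open>auto simp: awalk_Cons_iff\<close>)
    with * have "e \<in> parcs H" by (auto simp: H)
    with Cons.IH[OF *(3,4)] *(1) show ?case by (simp add: H.awalk_Cons_iff)
  qed
  have "b \<rightarrow>\<^sup>*\<^bsub>with_proj H\<^esub> r" "c \<rightarrow>\<^sup>*\<^bsub>with_proj H\<^esub> r"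
    using tr assms by (auto intro: H.reachable_awalkI)
  then have "b \<rightarrow>\<^sup>*\<^bsub>with_proj H\<^esub> c"
    using H.symmetric_reachable' H.reachable_trans by blast
  then obtain s where s: "H.apath b s c" using H.reachable_apath by auto
  then have "H.awalk b s c" "distinct (pawalk_verts b s)" by (auto simp: H.apath_def)
  then have "awalk b s c" by (auto simp: awalk_def H.awalk_def H)
  moreover have "set (pawalk_verts b s) \<subseteq> pverts H"
    using H.awalk_verts_in_verts[OF _ \<open>H.awalk b s c\<close>[unfolded H.awalk_def, THEN conjunct2, THEN conjunct1]]
      \<open>H.awalk b s c\<close> by (auto simp: H.awalk_def)
  ultimately show ?thesis using \<open>distinct _\<close> by (auto simp: apath_def H)
qed

lemma (in rooted_tree) ex1_parent:
  assumes "a \<in> pverts G" "a \<noteq> r"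
  shows "\<exists>!b. is_parent G r a b"
proof -
  have "a \<rightarrow>\<^sup>*\<^bsub>with_proj G\<^esub> r"
  proof -
    from connected assms root_in_verts show ?thesis by (auto simp: strongly_connected_def)
  qed
  then obtain p where p: "apath a p r" using reachable_apath by auto
  with assms have "p \<noteq> []" by (auto simp: apath_Nil_iff)
  then obtain b p' where "p = (a, b) # p'" using p
    by (cases p) (auto simp: apath_Cons_iff)
  with p have ex: "is_parent G r a b" by (auto simp: is_parent_def)
  have "b = c" if "is_parent G r a b" "is_parent G r a c" for b c
  proof (rule ccontr)
    assume "b \<noteq> c"
    from that obtain p q where pq: "apath a ((a, b) # p) r" "apath a ((a, c) # q) r"
      by (auto simp: is_parent_def)
    then have arcs: "(a, b) \<in> parcs G" "(a, c) \<in> parcs G" by (auto simp: apath_Cons_iff)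
    from pq have "apath b p r" "a \<notin> set (pawalk_verts b p)"
      "apath c q r" "a \<notin> set (pawalk_verts c q)"
      by (auto simp: apath_Cons_iff)
    then obtain s where s: "apath b s c" "a \<notin> set (pawalk_verts b s)"
      using walk_avoiding awalkI_apath by metis
    have ca: "(c, a) \<in> parcs G" using arcs(2) pair_sym_arcs by (auto simp: symmetric_def sym_def)
    let ?c = "(a, b) # s @ [(c, a)]"
    have aw: "awalk b s c" and d: "distinct (pawalk_verts b s)" using s(1) by (auto simp: apath_def)
    have vs: "pawalk_verts u (s @ [(c, a)]) = pawalk_verts u s @ [a]" if "pcas u s c" for u
      using that by (induction s arbitrary: u) auto
    have "awalk c [(c, a)] a"
      using ca by (auto simp: awalk_Cons_iff awalk_Nil_iff dest: in_arcsD2)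
    with aw have "awalk b (s @ [(c, a)]) a" by (rule awalk_appendI)
    then have "awalk a ?c a" using arcs(1) by (simp add: awalk_Cons_iff del: awalk_append_iff)
    moreover have "distinct (tl (pawalk_verts a ?c))"
      using d s(2) vs[of b] aw by (auto simp: awalk_def)
    moreover have "?c \<noteq> []" by simp
    ultimately have "cycle ?c" unfolding cycle_def by blast
    moreover have "s \<noteq> []" using \<open>b \<noteq> c\<close> aw by (auto simp: awalk_Nil_iff)
    then have "3 \<le> length ?c" by (cases s) auto
    ultimately show False using acyclic by blast
  qed
  with ex show ?thesis by blast
qed

lemma (in rooted_tree) is_parent_descent:
  assumes "a \<in> pverts G" "a \<noteq> r"
  shows "is_parent G r a (descent G r a)"
  unfolding descent_def by (rule theI') (rule ex1_parent[OF assms])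


section \<open>The universal tree\<close>

definition U :: "nat set" where
  "U = {n. 0 < n \<and> (\<forall>p q. prime p \<longrightarrow> prime q \<longrightarrow> p dvd n \<longrightarrow> q < p \<longrightarrow> q dvd n)}"

text \<open>Meaningful only for arguments in \<^term>\<open>U - {1}\<close>; the value at 1 is the empty product.\<close>

definition theta_U :: "nat \<Rightarrow> nat" where
  "theta_U n = (\<Prod>p \<in> prime_factors n - {Max (prime_factors n)}. p ^ multiplicity p n)"

definition universal_tree :: "nat pair_pre_digraph" where
  "universal_tree = \<lparr>pverts = U,
     parcs = {(n, theta_U n) |n. n \<in> U - {1}} \<union> {(theta_U n, n) |n. n \<in> U - {1}}\<rparr>"

lemma U_gt_1: "n > 1" if "n \<in> U" "n \<noteq> 1"
proof -
  from that have "0 < n" unfolding U_def by blast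
  with that show ?thesis by linarith
qed

lemma one_in_U: "1 \<in> U"
proof -
  have "\<not> p dvd 1" if "prime p" for p :: nat using that by auto
  then show ?thesis unfolding U_def by blast
qed

lemma prime_factors_nonempty:
  fixes n :: nat assumes "n > 1" shows "prime_factors n \<noteq> {}"
  using assms by (simp add: prime_factorization_empty_iff)

lemma theta_U_mult:
  assumes "n > 1"
  shows "n = theta_U n * Max (prime_factors n) ^ multiplicity (Max (prime_factors n)) n"
proof -
  let ?P = "Max (prime_factors n)"
  have P: "?P \<in> prime_factors n" using prime_factors_nonempty[OF assms] by (intro Max_in) auto
  have "n = (\<Prod>p \<in> prime_factors n. p ^ multiplicity p n)"
    using assms by (intro prime_factorization_nat) auto
  also have "\<dots> = ?P ^ multiplicity ?P n * theta_U n"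
    unfolding theta_U_def using P by (intro prod.remove) auto
  finally show ?thesis by (simp add: mult.commute)
qed

lemma theta_U_eq_div:
  assumes "n > 1"
  shows "theta_U n = n div Max (prime_factors n) ^ multiplicity (Max (prime_factors n)) n"
proof -
  have "Max (prime_factors n) \<in> prime_factors n"
    using prime_factors_nonempty[OF assms] by (intro Max_in) auto
  then have "Max (prime_factors n) > 0" by (auto dest: in_prime_factors_imp_prime simp: prime_gt_0_nat)
  then show ?thesis using theta_U_mult[OF assms]
    by (metis nonzero_mult_div_cancel_right power_not_zero less_numeral_extra(3))
qed

lemma theta_U_less:
  assumes "n > 1"
  shows "theta_U n < n" "0 < theta_U n"
proof -
  let ?P = "Max (prime_factors n)"
  have P: "?P \<in> prime_factors n" using prime_factors_nonempty[OF assms] by (intro Max_in) auto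
  then have "prime ?P" "multiplicity ?P n > 0" by (auto simp: prime_factors_multiplicity)
  then have gt1: "1 < ?P ^ multiplicity ?P n" by (intro one_less_power prime_gt_1_nat)
  show pos: "0 < theta_U n"
  proof (rule ccontr)
    assume "\<not> 0 < theta_U n"
    then have "theta_U n * ?P ^ multiplicity ?P n = 0" by simp
    with theta_U_mult[OF assms] have "n = 0" by (rule trans)
    with assms show False by simp
  qed
  have "theta_U n * 1 < theta_U n * ?P ^ multiplicity ?P n"
    using gt1 pos by (intro mult_strict_left_mono) auto
  then have "theta_U n < theta_U n * ?P ^ multiplicity ?P n" by (simp only: mult_1_right)
  also note theta_U_mult[OF assms, symmetric]
  finally show "theta_U n < n" .
qed

lemma prime_factors_theta_U:
  assumes "n > 1"
  shows "prime_factors (theta_U n) = prime_factors n - {Max (prime_factors n)}"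
proof -
  have "prime_factors (theta_U n) = {p. prime p \<and> multiplicity p (theta_U n) > 0}"
    by (auto simp: prime_factors_multiplicity)
  also have "\<dots> = prime_factors n - {Max (prime_factors n)}"
  proof -
    have "multiplicity p (theta_U n) =
        (if p \<in> prime_factors n - {Max (prime_factors n)} then multiplicity p n else 0)"
      if "prime p" for p
      unfolding theta_U_def
      by (subst multiplicity_prod_prime_powers) (auto simp: that in_prime_factors_imp_prime)
    then show ?thesis by (auto simp: prime_factors_multiplicity split: if_splits)
  qed
  finally show ?thesis .
qed

lemma theta_U_in_U:
  assumes "n \<in> U - {1}"
  shows "theta_U n \<in> U"
proof -
  from assms have n: "n > 1" using U_gt_1 by blast
  have mem: "p dvd theta_U n \<longleftrightarrow> p dvd n \<and> p \<noteq> Max (prime_factors n)" if "prime p" for p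
  proof -
    have "p dvd theta_U n \<longleftrightarrow> p \<in> prime_factors (theta_U n)"
      using that theta_U_less[OF n] by (auto simp: prime_factors_dvd)
    moreover have "p dvd n \<longleftrightarrow> p \<in> prime_factors n"
      using that n by (auto simp: prime_factors_dvd)
    ultimately show ?thesis using prime_factors_theta_U[OF n] by auto
  qed
  have le: "p \<le> Max (prime_factors n)" if "prime p" "p dvd n" for p
    using that n by (intro Max_ge) (auto simp: prime_factors_dvd)
  have "q dvd theta_U n" if "prime p" "prime q" "p dvd theta_U n" "q < p" for p q
  proof -
    from that mem have "p dvd n" "p \<le> Max (prime_factors n)" using le by auto
    moreover from assms this(1) that(1,2,4) have "q dvd n" unfolding U_def by blast
    ultimately show ?thesis using mem[OF that(2)] that(4) by simp
  qed
  then show ?thesis using theta_U_less(2)[OF n] unfolding U_def by blast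
qed

text \<open>Here \<open>enumerate {p. prime p} i\<close> is the prime number p_{i+1} of the usual 1-based numbering.\<close>

lemma theta_U_enumerate:
  fixes h :: "nat \<Rightarrow> nat"
  defines "pr \<equiv> enumerate {p::nat. prime p}"
  assumes "\<And>i. i \<le> m \<Longrightarrow> 1 \<le> h i"
  shows "(\<Prod>i\<le>m. pr i ^ h i) \<in> U - {1}"
    and "theta_U (\<Prod>i\<le>m. pr i ^ h i) = (\<Prod>i<m. pr i ^ h i)"
proof -
  have sm: "strict_mono pr" unfolding pr_def
    by (intro strict_monoI enumerate_mono) (auto simp: primes_infinite)
  then have inj: "inj pr" by (rule strict_mono_imp_inj_on)
  have pr: "prime (pr i)" for i
    using enumerate_in_set[OF primes_infinite, of i] by (simp add: pr_def)
  define n where "n = (\<Prod>i\<le>m. pr i ^ h i)"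
  have im: "n = (\<Prod>p\<in>pr ` {..m}. p ^ h (inv pr p))"
    unfolding n_def by (subst prod.reindex) (auto simp: inj intro: inj_on_subset[OF inj])
  have mult: "multiplicity p n = (if p \<in> pr ` {..m} then h (inv pr p) else 0)" if "prime p" for p
    unfolding im by (rule multiplicity_prod_prime_powers) (use that pr in blast)+
  have "p \<in> prime_factors n \<longleftrightarrow> p \<in> pr ` {..m}" for p
  proof (cases "prime p")
    case True
    show ?thesis
    proof (cases "p \<in> pr ` {..m}")
      case mem: True
      then obtain i where "p = pr i" "i \<le> m" by auto
      with assms(2)[of i] have "h (inv pr p) > 0" by (simp add: inv_f_f[OF inj])
      with mem True mult[OF True] show ?thesis by (simp add: prime_factors_multiplicity)
    next
      case False
      with mult[OF True] show ?thesis by (simp add: prime_factors_multiplicity)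
    qed
  next
    case False
    then show ?thesis using pr by (auto dest: in_prime_factors_imp_prime)
  qed
  then have pf: "prime_factors n = pr ` {..m}" by blast
  have pos: "n > 0" unfolding n_def using pr by (intro prod_pos) (auto simp: prime_gt_0_nat)
  have ne1: "n \<noteq> 1" using pf by auto
  have "q dvd n" if "prime p" "prime q" "p dvd n" "q < p" for p q
  proof -
    from that pos pf obtain i where i: "i \<le> m" "p = pr i" by (auto simp: prime_factors_dvd set_eq_iff)
    from \<open>prime q\<close> obtain k where k: "q = pr k"
      using enumerate_Ex[of "{p::nat. prime p}" q] primes_infinite unfolding pr_def by auto
    with that i sm have "k \<le> m" by (auto simp: strict_mono_less)
    with k pf show ?thesis by auto
  qed
  with pos have "n \<in> U" unfolding U_def by blast
  with ne1 show "(\<Prod>i\<le>m. pr i ^ h i) \<in> U - {1}" by (simp add: n_def)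
  have mx: "Max (prime_factors n) = pr m" unfolding pf
    using sm by (intro Max_eqI) (auto simp: strict_mono_less_eq)
  have rest: "prime_factors n - {pr m} = pr ` {..<m}"
    unfolding pf using inj by (auto simp: inj_eq nat_less_le)
  have "theta_U n = (\<Prod>i<m. pr i ^ multiplicity (pr i) n)"
    unfolding theta_U_def mx rest by (subst prod.reindex) (auto intro: inj_on_subset[OF inj])
  also have "\<dots> = (\<Prod>i<m. pr i ^ h i)"
    using pr by (intro prod.cong) (auto simp: mult inv_f_f[OF inj])
  finally show "theta_U (\<Prod>i\<le>m. pr i ^ h i) = (\<Prod>i<m. pr i ^ h i)" by (simp add: n_def)
qed

lemma cycle_arcs:
  assumes "pcas u p u" "i < length p"
  shows "fst (p ! i) = snd (p ! (if i = 0 then length p - 1 else i - 1))"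
proof -
  have "fst (p ! i) = (if i = 0 then u else snd (p ! (i - 1))) \<and>
      v = snd (p ! (length p - 1))" if "pcas u p v" "i < length p" for u v p i
    using that
  proof (induction p arbitrary: u i)
    case (Cons e p)
    show ?case
    proof (cases "p = []")
      case False
      then have "v = snd (p ! (length p - 1))" using Cons.IH[of "snd e" 0] Cons.prems by auto
      moreover have "fst ((e # p) ! i) = (if i = 0 then u else snd ((e # p) ! (i - 1)))"
        using Cons.IH[of "snd e" "i - 1"] Cons.prems by (cases i; cases "i - 1") auto
      ultimately show ?thesis using False by (cases p) auto
    qed (use Cons.prems in auto)
  qed simp
  from this[OF assms] show ?thesis by auto
qed

theorem universal_tree_rooted_tree: "rooted_tree universal_tree 1"
proof -
  let ?G = universal_tree
  have verts: "pverts ?G = U" by (simp add: universal_tree_def)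
  have arcs: "\<exists>n. n \<in> U \<and> theta_U n \<in> U \<and> theta_U n < n \<and> (e = (n, theta_U n) \<or> e = (theta_U n, n))"
    if "e \<in> parcs ?G" for e
  proof -
    from that obtain n where n: "n \<in> U - {1}" "e = (n, theta_U n) \<or> e = (theta_U n, n)"
      unfolding universal_tree_def by auto
    then have "n > 1" using U_gt_1 by blast
    with n theta_U_in_U[OF n(1)] theta_U_less(1) show ?thesis by blast
  qed
  interpret pair_bidirected_digraph ?G
  proof unfold_locales
    show "symmetric (with_proj ?G)" by (auto simp: symmetric_def sym_def universal_tree_def)
    fix e assume "e \<in> parcs ?G"
    then obtain n where "n \<in> U" "theta_U n \<in> U" "theta_U n < n"
      "e = (n, theta_U n) \<or> e = (theta_U n, n)" using arcs by blast
    then show "fst e \<in> pverts ?G" "snd e \<in> pverts ?G" "fst e \<noteq> snd e"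
      unfolding verts by (elim disjE; simp)+
  qed
  have one: "1 \<in> pverts ?G" using one_in_U verts by simp
  have reach: "n \<rightarrow>\<^sup>*\<^bsub>with_proj ?G\<^esub> 1" if "n \<in> pverts ?G" for n
    using that
  proof (induction n rule: less_induct)
    case (less n)
    show ?case
    proof (cases "n = 1")
      case True then show ?thesis using one reachable_refl by simp
    next
      case False
      with less.prems verts have n: "n \<in> U - {1}" by simp
      then have "n > 1" using U_gt_1 by blast
      then have "theta_U n \<rightarrow>\<^sup>*\<^bsub>with_proj ?G\<^esub> 1"
        using theta_U_in_U[OF n] theta_U_less(1)[of n] verts by (intro less.IH) simp_all
      moreover have "(n, theta_U n) \<in> parcs ?G" using n unfolding universal_tree_def by auto
      ultimately show ?thesis using adj_reachable_trans by auto
    qed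
  qed
  show ?thesis
  proof unfold_locales
    show "1 \<in> pverts ?G" by (rule one)
    show "strongly_connected (with_proj ?G)"
      unfolding strongly_connected_def
      using one reach reachable_trans[OF reach symmetric_reachable'[OF reach]] by auto
    show "\<not> (\<exists>p. cycle p \<and> 3 \<le> length p)"
    proof
      assume "\<exists>p. cycle p \<and> 3 \<le> length p"
      then obtain p u where p: "awalk u p u" "distinct (tl (pawalk_verts u p))" "3 \<le> length p"
        by (auto simp: cycle_def)
      have cas: "pcas u p u" and sub: "set p \<subseteq> parcs ?G" using p(1) by (auto simp: awalk_def)
      have "pawalk_verts u p = u # map snd p" if "pcas u p v" for u v
        using that
      proof (induction p arbitrary: u)
        case (Cons e p)
        then have "fst e = u" "pawalk_verts (snd e) p = snd e # map snd p" by simp_all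
        then show ?case by simp
      qed simp
      with cas have dist: "distinct (map snd p)" using p(2) by simp
      define x where "x = Max (snd ` set p)"
      have "p \<noteq> []" using p(3) by auto
      then have "x \<in> snd ` set p" unfolding x_def by (intro Max_in) auto
      then obtain i where i: "i < length p" "x = snd (p ! i)" by (auto simp: in_set_conv_nth)
      have mx: "snd (p ! k) \<le> x" if "k < length p" for k
        unfolding x_def using that by (intro Max_ge) auto
      define i1 where "i1 = (if i = 0 then length p - 1 else i - 1)"
      define i2 where "i2 = (if Suc i = length p then 0 else Suc i)"
      have i12: "i1 < length p" "i2 < length p" "i1 \<noteq> i2"
        using i p(3) by (auto simp: i1_def i2_def)
      have f1: "fst (p ! i) = snd (p ! i1)" using cycle_arcs[OF cas i(1)] by (simp add: i1_def)
      have "i = (if i2 = 0 then length p - 1 else i2 - 1)" using i(1) by (auto simp: i2_def)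
      then have f2: "fst (p ! i2) = x" using cycle_arcs[OF cas i12(2)] i(2) by simp
      have down: "v = theta_U x" if "(x, v) \<in> parcs ?G \<or> (v, x) \<in> parcs ?G" "v \<le> x" for v
      proof -
        from that arcs obtain n where "theta_U n < n" "(x, v) = (n, theta_U n) \<or> (v, x) = (n, theta_U n)"
          by blast
        with that(2) show ?thesis by auto
      qed
      have "p ! i \<in> parcs ?G" "p ! i2 \<in> parcs ?G"
        using sub nth_mem i(1) i12(2) by blast+
      then have "(snd (p ! i1), x) \<in> parcs ?G" "(x, snd (p ! i2)) \<in> parcs ?G"
        using i(2) f1 f2 by (metis prod.collapse)+
      then have "snd (p ! i1) = theta_U x" "snd (p ! i2) = theta_U x"
        using down mx i12 by blast+
      then show False using dist i12 by (metis distinct_conv_nth length_map nth_map)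
    qed
  qed
qed

theorem descent_universal_tree:
  assumes "n \<in> U - {1}"
  shows "descent universal_tree 1 n = theta_U n"
proof -
  interpret rooted_tree universal_tree 1 by (rule universal_tree_rooted_tree)
  have path: "\<exists>p. apath n p 1 \<and> set (pawalk_verts n p) \<subseteq> {..n} \<and> (n \<noteq> 1 \<longrightarrow> (\<exists>q. p = (n, theta_U n) # q))"
    if "n \<in> U" for n
    using that
  proof (induction n rule: less_induct)
    case (less n)
    show ?case
    proof (cases "n = 1")
      case True then show ?thesis using root_in_verts by (intro exI[of _ "[]"]) (auto simp: apath_Nil_iff)
    next
      case False
      with less.prems have n: "n \<in> U - {1}" "n > 1" using U_gt_1 by (simp, blast)
      note t = theta_U_less[OF n(2)] theta_U_in_U[OF n(1)]
      from less.IH[OF t(1,3)] obtain q where q: "apath (theta_U n) q 1"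
        "set (pawalk_verts (theta_U n) q) \<subseteq> {..theta_U n}" by auto
      have "(n, theta_U n) \<in> parcs universal_tree" using n by (auto simp: universal_tree_def)
      moreover have "n \<notin> set (pawalk_verts (theta_U n) q)" using q(2) t(1) by auto
      ultimately have "apath n ((n, theta_U n) # q) 1" using q(1) by (auto simp: apath_Cons_iff)
      then show ?thesis using q(2) t(1) by (intro exI[of _ "(n, theta_U n) # q"]) auto
    qed
  qed
  have "is_parent universal_tree 1 n (theta_U n)"
    using path[of n] assms by (auto simp: is_parent_def)
  moreover have "n \<in> pverts universal_tree" "n \<noteq> 1" using assms by (auto simp: universal_tree_def)
  ultimately show ?thesis using ex1_parent is_parent_descent by blast
qed

end

theory Submission
  imports Defs
begin

text \<open>
  Fix an injective numbering of the nodes. If \<open>r = a\<^sub>0, a\<^sub>1, \<dots>, a\<^sub>m = a\<close> is the path from the root to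
  \<open>a\<close>, send \<open>a\<close> to the product of the first \<open>m\<close> primes, the \<open>i\<close>-th one raised to one plus the number
  of \<open>a\<^sub>i\<close>. Stripping the largest prime removes \<open>a\<close> from the path, so the square commutes; and the
  exponent of the largest prime identifies \<open>a\<close>, so injectivity follows by induction on the depth.
\<close>

text \<open>Counting up to the first arrival at \<open>r\<close> avoids the value of
  \<open>descent G r\<close> at \<open>r\<close>, which is unspecified.\<close>

definition depth :: "'a pair_pre_digraph \<Rightarrow> 'a \<Rightarrow> 'a \<Rightarrow> nat" where
  "depth G r a = (LEAST n. (descent G r ^^ n) a = r)"

text \<open>\<open>enumerate\<close> counts from 0, so index \<open>i\<close> belongs to the
  ancestor at depth \<open>Suc i\<close>, and the root gives no factor. \<open>Suc\<close> keeps
  exponents positive where \<open>c\<close> is 0, so no prime is skipped.\<close>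

definition path_code :: "('a \<Rightarrow> nat) \<Rightarrow> 'a pair_pre_digraph \<Rightarrow> 'a \<Rightarrow> 'a \<Rightarrow> nat" where
  "path_code c G r a = (\<Prod>i<depth G r a. enumerate {p. prime p} i ^
     Suc (c ((descent G r ^^ (depth G r a - Suc i)) a)))"

lemma depth_root: "depth G r r = 0"
  unfolding depth_def by (rule Least_eq_0) simp

lemma path_code_root: "path_code c G r r = 1"
  by (simp add: path_code_def depth_root)

context rooted_tree
begin

lemma descent_in_verts:
  assumes "a \<in> pverts G" "a \<noteq> r"
  shows "descent G r a \<in> pverts G"
  using is_parent_descent[OF assms] by (auto simp: is_parent_def apath_Cons_iff dest: in_arcsD2)

text \<open>The tail of a simple path to the root is again such a path, so by uniqueness of parents
  each arc is one descent step.\<close>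

lemma descent_funpow_apath:
  assumes "apath a p r"
  shows "(descent G r ^^ length p) a = r"
  using assms
proof (induction p arbitrary: a)
  case Nil
  then show ?case by (simp add: apath_Nil_iff)
next
  case (Cons e p)
  then obtain b where e: "e = (a, b)" "apath b p r" "a \<notin> set (pawalk_verts b p)" "a \<in> pverts G"
    by (cases e) (auto simp: apath_Cons_iff dest: in_arcsD1)
  have "r \<in> set (pawalk_verts b p)"
    using awlast_in_verts[of b p] awalkI_apath[OF e(2)] by auto
  with e(3) have "a \<noteq> r" by blast
  moreover have "is_parent G r a b" using Cons.prems e(1) by (auto simp: is_parent_def)
  ultimately have "descent G r a = b" using e(4) ex1_parent is_parent_descent by blast
  with Cons.IH[OF e(2)] show ?case by (simp add: funpow_Suc_right del: funpow.simps)
qed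

lemma descent_reaches_root:
  assumes "a \<in> pverts G"
  shows "\<exists>n. (descent G r ^^ n) a = r"
proof -
  have "a \<rightarrow>\<^sup>*\<^bsub>with_proj G\<^esub> r"
    using connected assms root_in_verts by (auto simp: strongly_connected_def)
  then obtain p where "apath a p r" using reachable_apath by auto
  then show ?thesis using descent_funpow_apath by blast
qed

text \<open>As \<open>a\<close> is not the root, zero steps do not suffice; the first step leads to
  the parent.\<close>

lemma depth_descent:
  assumes "a \<in> pverts G" "a \<noteq> r"
  shows "depth G r a = Suc (depth G r (descent G r a))"
proof -
  obtain n where "(descent G r ^^ n) a = r" using descent_reaches_root[OF assms(1)] by blast
  then have "depth G r a = Suc (LEAST n. (descent G r ^^ Suc n) a = r)"
    unfolding depth_def by (rule Least_Suc) (simp add: assms(2))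
  then show ?thesis by (simp add: depth_def funpow_Suc_right del: funpow.simps)
qed

text \<open>The last equation isolates the power of the largest prime, from which \<open>c a\<close>
  is recovered for injectivity.\<close>

lemma path_code_descent:
  assumes "a \<in> pverts G" "a \<noteq> r"
  shows "path_code c G r a \<in> U - {1}"
    and "theta_U (path_code c G r a) = path_code c G r (descent G r a)"
    and "path_code c G r a = path_code c G r (descent G r a) *
      enumerate {p. prime p} (depth G r (descent G r a)) ^ Suc (c a)"
proof -
  define m where "m = depth G r (descent G r a)"
  define h where "h i = Suc (c ((descent G r ^^ (m - i)) a))" for i
  have code: "path_code c G r a = (\<Prod>i\<le>m. enumerate {p. prime p} i ^ h i)"
    by (simp add: path_code_def depth_descent[OF assms] m_def h_def lessThan_Suc_atMost)
  \<comment> \<open>Below index \<open>m\<close> at least one step is taken, and the first goes from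
    \<open>a\<close> to its parent: both codes share these factors. Only index \<open>m\<close>,
    with exponent \<open>Suc (c a)\<close>, is new.\<close>
  have "(descent G r ^^ (m - i)) a = (descent G r ^^ (m - Suc i)) (descent G r a)" if "i < m" for i
    using that by (metis Suc_diff_Suc funpow_Suc_right o_apply)
  then have desc: "path_code c G r (descent G r a) = (\<Prod>i<m. enumerate {p. prime p} i ^ h i)"
    unfolding path_code_def m_def[symmetric] h_def by (intro prod.cong) auto
  show "path_code c G r a \<in> U - {1}"
    unfolding code by (rule theta_U_enumerate(1)) (simp add: h_def)
  show "theta_U (path_code c G r a) = path_code c G r (descent G r a)"
    unfolding code desc by (rule theta_U_enumerate(2)) (simp add: h_def)
  show "path_code c G r a = path_code c G r (descent G r a) *
      enumerate {p. prime p} (depth G r (descent G r a)) ^ Suc (c a)"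
    unfolding code desc m_def[symmetric]
    by (simp add: lessThan_Suc_atMost[symmetric] h_def del: power_Suc)
qed

lemma path_code_in_U: "a \<in> pverts G \<Longrightarrow> path_code c G r a \<in> U"
  using path_code_descent(1) one_in_U by (cases "a = r") (auto simp: path_code_root)

lemma inj_on_path_code:
  assumes "inj_on c (pverts G)"
  shows "inj_on (path_code c G r) (pverts G)"
proof (rule inj_onI)
  fix a b assume "a \<in> pverts G" "b \<in> pverts G" "path_code c G r a = path_code c G r b"
  then show "a = b"
  proof (induction "depth G r a" arbitrary: a b rule: less_induct)
    case less
    show ?case
    proof (cases "a = r \<or> b = r")
      case True
      \<comment> \<open>Only the root has code 1.\<close>
      then show ?thesis
        using less.prems path_code_root path_code_descent(1)
        by (metis DiffD2 singletonI)
    next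
      case False
      then have ne: "a \<noteq> r" "b \<noteq> r" by auto
      note A = less.prems(1) ne(1) and B = less.prems(2) ne(2)
      let ?\<nu> = "descent G r" and ?j = "path_code c G r" and ?p = "enumerate {p::nat. prime p}"
      have eq: "?j (?\<nu> a) = ?j (?\<nu> b)"
        using path_code_descent(2)[OF A] path_code_descent(2)[OF B] less.prems(3) by metis
      then have parents: "?\<nu> a = ?\<nu> b"
        using less.hyps[OF _ descent_in_verts[OF A] descent_in_verts[OF B]] depth_descent[OF A] by simp
      \<comment> \<open>With equal parents, both codes have the same largest prime; cancelling the
        nonzero parent code leaves two powers of it to compare.\<close>
      have "?j (?\<nu> a) \<noteq> 0"
        using path_code_in_U[OF descent_in_verts[OF A]] by (auto simp: U_def)
      then have "?p (depth G r (?\<nu> a)) ^ Suc (c a) = ?p (depth G r (?\<nu> a)) ^ Suc (c b)"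
        using less.prems(3) path_code_descent(3)[OF A] path_code_descent(3)[OF B] parents
        by (metis mult_left_cancel)
      moreover have "?p (depth G r (?\<nu> a)) > 1"
        using enumerate_in_set[OF primes_infinite] prime_gt_1_nat by blast
      ultimately have "c a = c b" using power_inject_exp by blast
      with assms less.prems show ?thesis by (auto dest: inj_onD)
    qed
  qed
qed

end

theorem theorem11:
  fixes T :: "'a pair_pre_digraph" and \<epsilon> :: 'a
  assumes "rooted_tree T \<epsilon>"
    and "countable (pverts T)"
  shows "\<exists>j :: 'a \<Rightarrow> nat.
    j ` pverts T \<subseteq> pverts universal_tree \<and>
    inj_on j (pverts T) \<and>
    (\<forall>a \<in> pverts T - {\<epsilon>}. j a \<in> pverts universal_tree - {1} \<and> j (descent T \<epsilon> a) = theta_U (j a))"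
proof -
  interpret rooted_tree T \<epsilon> by (rule assms(1))
  obtain c :: "'a \<Rightarrow> nat" where "inj_on c (pverts T)"
    using assms(2) by (rule countableE)
  then have "inj_on (path_code c T \<epsilon>) (pverts T)" by (rule inj_on_path_code)
  moreover have "pverts universal_tree = U" by (simp add: universal_tree_def)
  ultimately show ?thesis
    using path_code_in_U path_code_descent(1,2)
    by (intro exI[of _ "path_code c T \<epsilon>"]) auto
qed

end
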